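(* Let $n\ge 1$, $1\le m\le n$ and $\alpha>0$. Suppose that the operator $\mathcal{M}_m^{\alpha}$ satisfies the integral comparison principle on $m$-plurisubharmonic functions, i.e. for every bounded domain $\Omega\subset\mathbb{C}^n$ and all $m$-plurisubharmonic functions $u,v\in\mathcal{C}^2(\Omega)\cap\mathcal{C}(\overline\Omega)$ with $u\ge v$ on $\partial\Omega$ one has $$\int_{\{u<v\}}\mathcal{M}_m(v)^{\alpha}\leq\int_{\{u<v\}}\mathcal{M}_m(u)^{\alpha}.$$ Then $\alpha=1$ and, furthermore, $m=1$ or $m=n$.
   Context: For a real-valued $u\in\mathcal{C}^2(\Omega)$ with $\Omega\subset\mathbb{C}^n$, let $\lambda_1(z)\le\dots\le\lambda_n(z)$ be the eigenvalues of the complex Hessian $\left(\frac{\partial^2u}{\partial z_p\partial\bar z_q}(z)\right)_{p,q=1}^n$. A $\mathcal{C}^2$ function $u$ is $m$-plurisubharmonic if the sum of the $m$ smallest eigenvalues $\lambda_1(z)+\dots+\lambda_m(z)$ is nonnegative at every $z\in\Omega$ (equivalently, $u$ restricted to every affine complex $m$-plane is subharmonic). The operator $\mathcal{M}_m$ is $$\mathcal{M}_m(u)(z):=\prod_{1\leq j_1<j_2<\cdots<j_m\leq n}\bigl(\lambda_{j_1}(z)+\lambda_{j_2}(z)+\cdots+\lambda_{j_m}(z)\bigr),$$ which is nonnegative for $m$-plurisubharmonic $u$, and $\mathcal{M}_m^\alpha(u)=\mathcal{M}_m(u)^\alpha$. Integrals are with respect to Lebesgue measure on $\mathbb{C}^n$,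 with values in $[0,\infty]$. *)

theory Defs
  imports
    "HOL-Analysis.Analysis"
    "HOL-Computational_Algebra.Computational_Algebra"
begin

definition C2_on :: "'a::real_normed_vector set \<Rightarrow> ('a \<Rightarrow> 'b::real_normed_vector) \<Rightarrow> bool" where
  "C2_on \<Omega> u \<longleftrightarrow>
     (\<exists>(u' :: 'a \<Rightarrow> 'a \<Rightarrow>\<^sub>L 'b) (u'' :: 'a \<Rightarrow> 'a \<Rightarrow>\<^sub>L 'a \<Rightarrow>\<^sub>L 'b).
        (\<forall>z\<in>\<Omega>. (u has_derivative blinfun_apply (u' z)) (at z)) \<and>
        (\<forall>z\<in>\<Omega>. (u' has_derivative blinfun_apply (u'' z)) (at z)) \<and>
        continuous_on \<Omega> u'')"

definition dir_deriv :: "'a::real_normed_vector \<Rightarrow> ('a \<Rightarrow> complex) \<Rightarrow> 'a \<Rightarrow> complex" where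
  "dir_deriv w f z = vector_derivative (\<lambda>t. f (z + t *\<^sub>R w)) (at 0)"

(* Wirtinger derivatives: axis p 1 and axis p \<i> are the real directions x_p and y_p, z_p = x_p + \<i> y_p. *)

definition d_z :: "'n::finite \<Rightarrow> (complex^'n \<Rightarrow> complex) \<Rightarrow> complex^'n \<Rightarrow> complex" where
  "d_z p f z = (dir_deriv (axis p 1) f z - \<i> * dir_deriv (axis p \<i>) f z) / 2"

definition d_zbar :: "'n::finite \<Rightarrow> (complex^'n \<Rightarrow> complex) \<Rightarrow> complex^'n \<Rightarrow> complex" where
  "d_zbar q f z = (dir_deriv (axis q 1) f z + \<i> * dir_deriv (axis q \<i>) f z) / 2"

definition complex_hessian :: "(complex^'n \<Rightarrow> real) \<Rightarrow> complex^'n \<Rightarrow> complex^'n^'n::finite" where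
  "complex_hessian u z = (\<chi> p q. d_z p (d_zbar q (\<lambda>w. complex_of_real (u w))) z)"

definition charpoly :: "complex^'n^'n \<Rightarrow> complex poly" where
  "charpoly A = det (\<chi> i j. (if i = j then [:0, 1:] else 0) - [:A $ i $ j:])"

(* The complex Hessian of a real C2 function is Hermitian, so all roots of its characteristic
   polynomial are real and Re only changes the type. Eigenvalues are listed in increasing
   order, with multiplicity. *)
definition eigenvalue_list :: "complex^'n^'n \<Rightarrow> real list" where
  "eigenvalue_list A = sorted_list_of_multiset (image_mset Re (proots (charpoly A)))"

(* j ranges over 1, ..., n, hence the index shift. *)
definition hess_eigenvalue :: "(complex^'n \<Rightarrow> real) \<Rightarrow> complex^'n \<Rightarrow> nat \<Rightarrow> real" where
  "hess_eigenvalue u z j = eigenvalue_list (complex_hessian u z) ! (j - 1)"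

definition m_psh :: "nat \<Rightarrow> (complex^'n) set \<Rightarrow> (complex^'n \<Rightarrow> real) \<Rightarrow> bool" where
  "m_psh m \<Omega> u \<longleftrightarrow> C2_on \<Omega> u \<and> (\<forall>z\<in>\<Omega>. 0 \<le> (\<Sum>j=1..m. hess_eigenvalue u z j))"

(* The increasing tuples j_1 < ... < j_m are encoded as the m-element subsets of {1..n}. *)
definition MA_op :: "nat \<Rightarrow> (complex^'n \<Rightarrow> real) \<Rightarrow> complex^'n \<Rightarrow> real" where
  "MA_op m u z = (\<Prod>J | J \<subseteq> {1..CARD('n)} \<and> card J = m. \<Sum>j\<in>J. hess_eigenvalue u z j)"

end

theory Submission
  imports Defs
begin

text \<open>The comparison principle makes the density \<open>F = M\<^sub>m\<^sup>\<alpha>\<close> behave like a null Lagrangian in the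
  direction of rank-one matrices: restricted to positive diagonal matrices, \<open>F\<close> must be affine in
  each eigenvalue separately. Indeed, if \<open>F\<close> were strictly convex in one eigenvalue \<open>\<lambda>\<^sub>l\<close> near a
  diagonal matrix \<open>A\<close>, then adding a ripple of amplitude \<open>1/k\<^sup>2\<close> and frequency \<open>k\<close> in the variable
  \<open>Re z\<^sub>l\<close> to the larger function would hardly change the functions and the set where they are
  compared, but would raise the average of \<open>F\<close> by Jensen's inequality. If \<open>F\<close> were strictly concave, a
  ripple in the smaller function would lower its average. Both contradict the comparison principle
  (\<open>comparison_of_quarter_averages\<close>, \<open>no_strict_midpoint_convexity\<close>,
  \<open>no_strict_midpoint_concavity\<close>). The two functions are separated by the multiple
  \<open>\<tau> (1 - |z|\<^sup>2)\<close>, whose positivity set is the unit ball. All Hessians involved are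
  diagonal, with explicit eigenvalues (\<open>complex_hessian_rippled_quadratic\<close>).

  As a function of \<open>\<lambda>\<^sub>l\<close>, the density is a constant times the power \<open>\<alpha>\<close> of a product of affine
  factors \<open>\<lambda>\<^sub>l + s\<^sub>J\<close>, one for each \<open>m\<close>-subset \<open>J\<close> of the indices that contains \<open>l\<close>. With \<open>x\<^sub>J\<close>
  the reciprocals of these factors, the vanishing of the second derivative reads
  \<open>\<alpha> (\<Sum> x\<^sub>J)\<^sup>2 = \<Sum> x\<^sub>J\<^sup>2\<close> (\<open>second_derivative_vanishes\<close>). Taking all eigenvalues equal to \<open>1\<close>
  yields \<open>\<alpha> K = 1\<close> for the number \<open>K\<close> of factors. Then Cauchy-Schwarz forces all \<open>x\<^sub>J\<close> to be equal
  for every choice of eigenvalues, which fails for \<open>1 < m < n\<close>. For \<open>m = 1\<close> and \<open>m = n\<close> there is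
  just one factor, so \<open>\<alpha> = 1\<close> (\<open>comparison_principle_imp\<close>).\<close>

unbundle no fps_syntax

section \<open>The operator on functions with diagonal complex Hessian\<close>
definition subset_sum_prod :: "nat \<Rightarrow> ('n::finite \<Rightarrow> real) \<Rightarrow> real" where
  "subset_sum_prod m d = (\<Prod>J | card J = m. \<Sum>i\<in>J. d i)"

lemma eigenvalue_list_diagonal:
  fixes d :: "'n::finite \<Rightarrow> real"
  assumes "A = (\<chi> p q. if p = q then complex_of_real (d p) else 0)"
  shows "eigenvalue_list A = sorted_list_of_multiset (image_mset d (mset_set UNIV))"
proof -
  have "charpoly A = (\<Prod>i\<in>UNIV. [:- complex_of_real (d i), 1:])"
    unfolding charpoly_def by (subst det_diagonal) (auto simp: assms)
  then have "proots (charpoly A) = (\<Sum>i\<in>UNIV. {# complex_of_real (d i) #})"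
    by (simp add: proots_prod)
  also have "\<dots> = image_mset (\<lambda>i. complex_of_real (d i)) (mset_set UNIV)"
    by (simp add: sum_unfold_sum_mset)
  finally show ?thesis
    by (simp add: eigenvalue_list_def multiset.map_comp comp_def)
qed

text \<open>Sorting the diagonal entries amounts to relabelling the coordinates by a bijection
  \<open>\<sigma>\<close>; products over all index sets of a given size are invariant under it.\<close>
lemma diagonal_hessian_enumeration:
  fixes d :: "'n::finite \<Rightarrow> real"
  assumes H: "complex_hessian u z = (\<chi> p q. if p = q then complex_of_real (d p) else 0)"
  obtains \<sigma> where "bij_betw \<sigma> {1..CARD('n)} (UNIV :: 'n set)"
    and "\<And>j. j \<in> {1..CARD('n)} \<Longrightarrow> hess_eigenvalue u z j = d (\<sigma> j)"
proof -
  obtain ys :: "'n list" where ys: "set ys = UNIV" "distinct ys"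
    using finite_distinct_list[of "UNIV :: 'n set"] by auto
  define zs where "zs = sort_key d ys"
  have zs: "set zs = UNIV" "distinct zs"
    using ys by (simp_all add: zs_def)
  then have len: "length zs = CARD('n)"
    using distinct_card by fastforce
  have "mset_set UNIV = mset zs"
    using zs mset_set_set by metis
  then have "image_mset d (mset_set UNIV) = mset (map d zs)"
    by simp
  moreover have "sorted (map d zs)"
    by (simp add: zs_def)
  ultimately have ev: "eigenvalue_list (complex_hessian u z) = map d zs"
    using eigenvalue_list_diagonal[OF H] sorted_list_of_multiset_mset sorted_sort_id by metis
  have "bij_betw ((!) zs) {..<CARD('n)} UNIV"
    using bij_betw_nth[OF zs(2)] zs(1) len by auto
  moreover have "bij_betw (\<lambda>j::nat. j - 1) {1..CARD('n)} {..<CARD('n)}"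
    by (rule bij_betwI[where g = Suc]) auto
  ultimately have "bij_betw ((!) zs \<circ> (\<lambda>j. j - 1)) {1..CARD('n)} UNIV"
    by (rule bij_betw_trans[rotated])
  moreover have "hess_eigenvalue u z j = d (((!) zs \<circ> (\<lambda>j. j - 1)) j)"
    if "j \<in> {1..CARD('n)}" for j
    using that len by (auto simp: hess_eigenvalue_def ev)
  ultimately show ?thesis
    by (rule that)
qed

lemma MA_op_diagonal:
  fixes d :: "'n::finite \<Rightarrow> real"
  assumes H: "complex_hessian u z = (\<chi> p q. if p = q then complex_of_real (d p) else 0)"
  shows "MA_op m u z = subset_sum_prod m d"
proof -
  obtain \<sigma> where \<sigma>: "bij_betw \<sigma> {1..CARD('n)} (UNIV :: 'n set)"
    and ev: "\<And>j. j \<in> {1..CARD('n)} \<Longrightarrow> hess_eigenvalue u z j = d (\<sigma> j)"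
    using diagonal_hessian_enumeration[OF H] by metis
  have bij: "bij_betw (image \<sigma>) {J. J \<subseteq> {1..CARD('n)} \<and> card J = m} {J. card J = m}"
  proof -
    have "bij_betw (image \<sigma>) {J \<in> Pow {1..CARD('n)}. card J = m} {J \<in> Pow UNIV. card J = m}"
      by (rule bij_betw_Collect[OF bij_betw_Pow[OF \<sigma>]])
         (metis PowD \<sigma> bij_betw_imp_inj_on card_image inj_on_subset)
    then show ?thesis by simp
  qed
  have "MA_op m u z = (\<Prod>J | J \<subseteq> {1..CARD('n)} \<and> card J = m. \<Sum>i\<in>\<sigma> ` J. d i)"
    unfolding MA_op_def
  proof (intro prod.cong refl)
    fix J assume "J \<in> {J. J \<subseteq> {1..CARD('n)} \<and> card J = m}"
    then have J: "J \<subseteq> {1..CARD('n)}" by simp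
    then have "inj_on \<sigma> J"
      using \<sigma> by (meson bij_betw_imp_inj_on inj_on_subset)
    then show "(\<Sum>j\<in>J. hess_eigenvalue u z j) = (\<Sum>i\<in>\<sigma> ` J. d i)"
      using J by (auto simp: sum.reindex ev intro!: sum.cong)
  qed
  also have "\<dots> = subset_sum_prod m d"
    unfolding subset_sum_prod_def using prod.reindex_bij_betw[OF bij] by simp
  finally show ?thesis .
qed

lemma m_psh_diagonalI:
  fixes u :: "complex^'n::finite \<Rightarrow> real"
  assumes C2: "C2_on \<Omega> u" and m: "m \<le> CARD('n)"
    and H: "\<And>z. z \<in> \<Omega> \<Longrightarrow>
      complex_hessian u z = (\<chi> p q. if p = q then complex_of_real (d z p) else 0)"
    and nonneg: "\<And>z p. z \<in> \<Omega> \<Longrightarrow> 0 \<le> d z p"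
  shows "m_psh m \<Omega> u"
  unfolding m_psh_def
proof (intro conjI C2 ballI sum_nonneg)
  fix z j assume z: "z \<in> \<Omega>" and "j \<in> {1..m}"
  then have j: "j \<in> {1..CARD('n)}" using m by auto
  obtain \<sigma> where "\<And>j. j \<in> {1..CARD('n)} \<Longrightarrow> hess_eigenvalue u z j = d z (\<sigma> j)"
    using diagonal_hessian_enumeration[OF H[OF z]] by metis
  then show "0 \<le> hess_eigenvalue u z j"
    using j nonneg[OF z] by simp
qed

section \<open>The test functions\<close>

text \<open>The ripple depends on the real part of one coordinate alone, so that the complex Hessian is
  diagonal at every point and its eigenvalues are explicit.\<close>
definition rippled_quadratic ::
    "('n::finite \<Rightarrow> real) \<Rightarrow> real \<Rightarrow> 'n \<Rightarrow> real \<Rightarrow> real \<Rightarrow> complex^'n \<Rightarrow> real" where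
  "rippled_quadratic a c l \<epsilon> k z =
     (\<Sum>i\<in>UNIV. a i * (cmod (z $ i))\<^sup>2) + c + \<epsilon> * cos (k * Re (z $ l))"

lemma C2_on_add:
  assumes "C2_on \<Omega> u" "C2_on \<Omega> v"
  shows "C2_on \<Omega> (\<lambda>z. u z + v z)"
proof -
  obtain u' u'' where u: "\<forall>z\<in>\<Omega>. (u has_derivative blinfun_apply (u' z)) (at z)"
      "\<forall>z\<in>\<Omega>. (u' has_derivative blinfun_apply (u'' z)) (at z)" "continuous_on \<Omega> u''"
    using assms(1) unfolding C2_on_def by blast
  obtain v' v'' where v: "\<forall>z\<in>\<Omega>. (v has_derivative blinfun_apply (v' z)) (at z)"
      "\<forall>z\<in>\<Omega>. (v' has_derivative blinfun_apply (v'' z)) (at z)" "continuous_on \<Omega> v''"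
    using assms(2) unfolding C2_on_def by blast
  show ?thesis
    unfolding C2_on_def
  proof (intro exI conjI ballI)
    fix z assume z: "z \<in> \<Omega>"
    show "((\<lambda>z. u z + v z) has_derivative blinfun_apply (u' z + v' z)) (at z)"
      using has_derivative_add u(1) v(1) z by (fastforce simp: plus_blinfun.rep_eq)
    show "((\<lambda>z. u' z + v' z) has_derivative blinfun_apply (u'' z + v'' z)) (at z)"
      using has_derivative_add u(2) v(2) z by (fastforce simp: plus_blinfun.rep_eq)
  next
    show "continuous_on \<Omega> (\<lambda>z. u'' z + v'' z)"
      using u(3) v(3) by (rule continuous_on_add)
  qed
qed

text \<open>Every summand of a rippled quadratic is a ridge function \<open>z \<mapsto> g (z \<bullet> e)\<close>, for
  which the two derivatives required by the definition can be written down explicitly as bounded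
  linear maps.\<close>
lemma C2_on_ridge:
  fixes g :: "real \<Rightarrow> real" and e :: "'a::real_inner"
  assumes g: "\<And>x. (g has_real_derivative g' x) (at x)"
    and g': "\<And>x. (g' has_real_derivative g'' x) (at x)"
    and cont: "continuous_on UNIV g''"
  shows "C2_on \<Omega> (\<lambda>z. g (z \<bullet> e))"
proof -
  define L :: "'a \<Rightarrow>\<^sub>L real" where "L = blinfun_inner_left e"
  have L [simp]: "blinfun_apply L w = w \<bullet> e" for w
    by (simp add: L_def inner_commute)
  have inner: "((\<lambda>z. z \<bullet> e) has_derivative (\<lambda>w. w \<bullet> e)) (at z)" for z :: 'a
    by (auto intro!: derivative_eq_intros)
  define LL :: "'a \<Rightarrow>\<^sub>L 'a \<Rightarrow>\<^sub>L real" where "LL = blinfun_scaleR_left L o\<^sub>L L"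
  have LL [simp]: "blinfun_apply LL w = (w \<bullet> e) *\<^sub>R L" for w
    by (simp add: LL_def)
  show ?thesis
    unfolding C2_on_def
  proof (intro exI conjI ballI)
    fix z :: 'a
    have "((\<lambda>z. g (z \<bullet> e)) has_derivative (\<lambda>w. (w \<bullet> e) * g' (z \<bullet> e))) (at z)"
      using has_derivative_compose[OF inner g[unfolded has_field_derivative_def]]
      by (simp add: mult.commute)
    then show "((\<lambda>z. g (z \<bullet> e)) has_derivative blinfun_apply (g' (z \<bullet> e) *\<^sub>R L)) (at z)"
      by (rule has_derivative_eq_rhs) (auto simp: scaleR_blinfun.rep_eq)
    have "((\<lambda>z. g' (z \<bullet> e)) has_derivative (\<lambda>w. (w \<bullet> e) * g'' (z \<bullet> e))) (at z)"
      using has_derivative_compose[OF inner g'[unfolded has_field_derivative_def]]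
      by (simp add: mult.commute)
    then have "((\<lambda>z. g' (z \<bullet> e) *\<^sub>R L) has_derivative
        (\<lambda>w. ((w \<bullet> e) * g'' (z \<bullet> e)) *\<^sub>R L)) (at z)"
      by (rule has_derivative_scaleR_left)
    then show "((\<lambda>z. g' (z \<bullet> e) *\<^sub>R L) has_derivative blinfun_apply (g'' (z \<bullet> e) *\<^sub>R LL)) (at z)"
      by (rule has_derivative_eq_rhs) (auto simp: scaleR_blinfun.rep_eq mult.commute)
  next
    show "continuous_on \<Omega> (\<lambda>z. g'' (z \<bullet> e) *\<^sub>R LL)"
      by (intro continuous_intros continuous_on_compose2[OF cont]) auto
  qed
qed

lemma C2_on_sum:
  assumes "finite I" "\<And>i. i \<in> I \<Longrightarrow> C2_on \<Omega> (u i)"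
  shows "C2_on \<Omega> (\<lambda>z. \<Sum>i\<in>I. u i z :: real)"
  using assms
proof (induction rule: finite_induct)
  case empty
  have "C2_on \<Omega> (\<lambda>z. 0 :: real)"
    unfolding C2_on_def
    by (intro exI[of _ "\<lambda>_. 0"] conjI) (auto simp: zero_blinfun.rep_eq[abs_def])
  then show ?case by simp
next
  case (insert i I)
  then show ?case
    by (simp add: C2_on_add)
qed

lemma C2_on_rippled_quadratic:
  fixes a :: "'n::finite \<Rightarrow> real"
  shows "C2_on \<Omega> (rippled_quadratic a c l \<epsilon> k)"
proof -
  have sq: "C2_on \<Omega> (\<lambda>z. b * (z \<bullet> axis i e)\<^sup>2)" for b :: real and i :: 'n and e :: complex
    by (rule C2_on_ridge[where g = "\<lambda>x. b * x\<^sup>2" and g' = "\<lambda>x. b * (2 * x)" and g'' = "\<lambda>x. b * 2"])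
       (auto intro!: derivative_eq_intros)
  have wave: "C2_on \<Omega> (\<lambda>z. c + \<epsilon> * cos (k * (z \<bullet> axis l (1::complex))))"
    by (rule C2_on_ridge[where g = "\<lambda>x. c + \<epsilon> * cos (k * x)"
          and g' = "\<lambda>x. - \<epsilon> * (k * sin (k * x))" and g'' = "\<lambda>x. - \<epsilon> * (k * (k * cos (k * x)))"])
       (auto intro!: derivative_eq_intros continuous_intros)
  have "rippled_quadratic a c l \<epsilon> k = (\<lambda>z. (\<Sum>i\<in>UNIV. a i * (z \<bullet> axis i 1)\<^sup>2 + a i * (z \<bullet> axis i \<i>)\<^sup>2)
      + (c + \<epsilon> * cos (k * (z \<bullet> axis l 1))))"
    by (rule ext) (simp add: rippled_quadratic_def inner_axis cmod_power2 inner_complex_def algebra_simps)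
  then show ?thesis
    by (simp only:) (intro C2_on_add C2_on_sum sq wave finite)
qed

lemma continuous_on_rippled_quadratic: "continuous_on S (rippled_quadratic a c l \<epsilon> k)"
  unfolding rippled_quadratic_def[abs_def] by (intro continuous_intros)

lemma dir_deriv_eqI:
  "((\<lambda>t. f (z + t *\<^sub>R w)) has_vector_derivative D) (at 0) \<Longrightarrow> dir_deriv w f z = D"
  unfolding dir_deriv_def by (rule vector_derivative_at)

text \<open>Since \<open>4 \<partial>\<^sup>2/\<partial>z\<partial>\<zeta> = \<Delta>\<close> in one variable \<open>z\<close> with conjugate \<open>\<zeta>\<close>, the quadratic part
  contributes \<open>a\<close> to the diagonal, and a ripple of amplitude \<open>\<epsilon>\<close> and frequency \<open>k\<close> contributes
  \<open>- \<epsilon> k\<^sup>2 / 4\<close> times the cosine. An amplitude of order \<open>1/k\<^sup>2\<close> is therefore invisible in the values for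
  large \<open>k\<close>, but changes one eigenvalue by a fixed amount.\<close>
lemma complex_hessian_rippled_quadratic:
  fixes a :: "'n::finite \<Rightarrow> real"
  shows "complex_hessian (rippled_quadratic a c l \<epsilon> k) z =
    (\<chi> p q. if p = q then complex_of_real ((a(l := a l - \<epsilon> * k\<^sup>2 / 4 * cos (k * Re (z $ l)))) p) else 0)"
proof -
  define u where "u = rippled_quadratic a c l \<epsilon> k"
  have dir: "dir_deriv (axis q e) (\<lambda>w. complex_of_real (u w)) z =
      complex_of_real (2 * a q * (Re (z $ q) * Re e + Im (z $ q) * Im e)
        - (if q = l then \<epsilon> * k * sin (k * Re (z $ l)) * Re e else 0))"
    for q :: 'n and e :: complex and z
  proof (rule dir_deriv_eqI)
    have square: "((\<lambda>t. a i * (cmod ((z + t *\<^sub>R axis q e) $ i))\<^sup>2) has_real_derivative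
        (if i = q then 2 * a q * (Re (z $ q) * Re e + Im (z $ q) * Im e) else 0)) (at 0)" for i
      by (auto simp: axis_def cmod_power2 intro!: derivative_eq_intros simp: algebra_simps)
    have wave: "((\<lambda>t. \<epsilon> * cos (k * Re ((z + t *\<^sub>R axis q e) $ l))) has_real_derivative
        - (if q = l then \<epsilon> * k * sin (k * Re (z $ l)) * Re e else 0)) (at 0)"
      by (auto simp: axis_def intro!: derivative_eq_intros)
    have "((\<lambda>t. u (z + t *\<^sub>R axis q e)) has_real_derivative
        ((\<Sum>i\<in>UNIV. (if i = q then 2 * a q * (Re (z $ q) * Re e + Im (z $ q) * Im e) else 0)) + 0
        + - (if q = l then \<epsilon> * k * sin (k * Re (z $ l)) * Re e else 0))) (at 0)"
      unfolding u_def rippled_quadratic_def by (intro DERIV_add DERIV_sum DERIV_const square wave)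
    then have "((\<lambda>t. u (z + t *\<^sub>R axis q e)) has_real_derivative
        2 * a q * (Re (z $ q) * Re e + Im (z $ q) * Im e)
        - (if q = l then \<epsilon> * k * sin (k * Re (z $ l)) * Re e else 0)) (at 0)"
      by simp
    then show "((\<lambda>t. complex_of_real (u (z + t *\<^sub>R axis q e))) has_vector_derivative complex_of_real
        (2 * a q * (Re (z $ q) * Re e + Im (z $ q) * Im e)
        - (if q = l then \<epsilon> * k * sin (k * Re (z $ l)) * Re e else 0))) (at 0)"
      by (rule has_vector_derivative_of_real)
  qed
  have zbar: "d_zbar q (\<lambda>w. complex_of_real (u w)) =
      (\<lambda>z. a q * z $ q - (if q = l then \<epsilon> * k / 2 * sin (k * Re (z $ l)) else 0))" for q
    by (rule ext) (simp add: d_zbar_def dir complex_eq_iff)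
  have dir2: "dir_deriv (axis p e)
       (\<lambda>z. a q * z $ q - (if q = l then \<epsilon> * k / 2 * sin (k * Re (z $ l)) else 0)) z =
      (if p = q then a q * e - (if q = l then \<epsilon> * k\<^sup>2 / 2 * cos (k * Re (z $ l)) * Re e else 0) else 0)"
    for p q :: 'n and e :: complex
  proof (rule dir_deriv_eqI)
    have lin: "((\<lambda>t. a q * (z + t *\<^sub>R axis p e) $ q) has_vector_derivative
        (if p = q then a q * e else 0)) (at 0)"
      by (auto simp: axis_def intro!: derivative_eq_intros)
    have "((\<lambda>t. \<epsilon> * k / 2 * sin (k * Re ((z + t *\<^sub>R axis p e) $ l))) has_real_derivative
        (if p = l then \<epsilon> * k\<^sup>2 / 2 * cos (k * Re (z $ l)) * Re e else 0)) (at 0)"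
      by (auto simp: axis_def power2_eq_square intro!: derivative_eq_intros)
    then have wave: "((\<lambda>t. complex_of_real (\<epsilon> * k / 2 * sin (k * Re ((z + t *\<^sub>R axis p e) $ l))))
        has_vector_derivative complex_of_real
        (if p = l then \<epsilon> * k\<^sup>2 / 2 * cos (k * Re (z $ l)) * Re e else 0)) (at 0)"
      by (rule has_vector_derivative_of_real)
    show "((\<lambda>t. a q * (z + t *\<^sub>R axis p e) $ q -
        (if q = l then \<epsilon> * k / 2 * sin (k * Re ((z + t *\<^sub>R axis p e) $ l)) else 0))
        has_vector_derivative (if p = q then a q * e -
          (if q = l then \<epsilon> * k\<^sup>2 / 2 * cos (k * Re (z $ l)) * Re e else 0) else 0)) (at 0)"
      using has_vector_derivative_diff[OF lin wave] lin by (cases "q = l"; cases "p = q") auto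
  qed
  show ?thesis
    unfolding complex_hessian_def u_def[symmetric] zbar d_z_def dir2
    by (auto simp: vec_eq_iff complex_eq_iff field_simps)
qed

section \<open>Oscillating integrands on balls\<close>
lemma nn_integral_ball_shift:
  fixes e :: "'a::euclidean_space" and G :: "real \<Rightarrow> ennreal"
  assumes [measurable]: "G \<in> borel_measurable borel" and e: "norm e = 1"
  shows "(\<integral>\<^sup>+z\<in>ball 0 (R - \<bar>s\<bar>). G (k * (z \<bullet> e) + k * s) \<partial>lborel)
    \<le> (\<integral>\<^sup>+z\<in>ball 0 R. G (k * (z \<bullet> e)) \<partial>lborel)"
proof -
  have ee: "e \<bullet> e = 1"
    using e by (simp add: norm_eq_1)
  have "(\<integral>\<^sup>+z\<in>ball 0 R. G (k * (z \<bullet> e)) \<partial>lborel)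
      = (\<integral>\<^sup>+z\<in>ball 0 R. G (k * (z \<bullet> e)) \<partial>distr lborel borel ((+) (s *\<^sub>R e)))"
    by (simp add: lborel_distr_plus)
  also have "\<dots> = (\<integral>\<^sup>+z. G (k * ((s *\<^sub>R e + z) \<bullet> e)) * indicator (ball 0 R) (s *\<^sub>R e + z) \<partial>lborel)"
    by (subst nn_integral_distr) (measurable, simp_all)
  also have "\<dots> \<ge> (\<integral>\<^sup>+z\<in>ball 0 (R - \<bar>s\<bar>). G (k * (z \<bullet> e) + k * s) \<partial>lborel)"
  proof (rule nn_integral_mono)
    fix z :: 'a
    have "s *\<^sub>R e + z \<in> ball 0 R" if "z \<in> ball 0 (R - \<bar>s\<bar>)"
      using that norm_triangle_ineq[of "s *\<^sub>R e" z] e by simp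
    then show "G (k * (z \<bullet> e) + k * s) * indicator (ball 0 (R - \<bar>s\<bar>)) z
        \<le> G (k * ((s *\<^sub>R e + z) \<bullet> e)) * indicator (ball 0 R) (s *\<^sub>R e + z)"
      by (auto simp: indicator_def inner_add_left ee algebra_simps)
  qed
  finally show ?thesis .
qed

text \<open>Four equidistant phases are enough to average the function of the cosine that occurs below:
  they produce the values \<open>\<plusminus> cos \<theta>\<close> and \<open>\<plusminus> sin \<theta>\<close>, and \<open>cos\<^sup>2 \<theta> + sin\<^sup>2 \<theta> = 1\<close> makes the
  second-order term independent of the phase.\<close>
definition quarter_sum :: "(real \<Rightarrow> 'b::comm_monoid_add) \<Rightarrow> real \<Rightarrow> 'b" where
  "quarter_sum G \<theta> = (\<Sum>j<4::nat. G (\<theta> + j * (pi / 2)))"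

text \<open>Translating the ball by up to three quarters of a period \<open>2 * pi / k\<close> in the direction
  \<open>e\<close> changes the phase of the integrand by the multiples of \<open>pi / 2\<close>. The
  four translates of the smaller ball stay inside the larger one, and the sum of the four
  integrals has an integrand that is bounded below by the quarter sums. For high frequency the loss
  in the radius is negligible, so this replaces a weak convergence argument.\<close>
lemma nn_integral_ball_ge_quarter_average:
  fixes e :: "'a::euclidean_space" and G :: "real \<Rightarrow> ennreal"
  assumes G [measurable]: "G \<in> borel_measurable borel" and e: "norm e = 1" and k: "k > 0"
    and avg: "\<And>\<theta>. 4 * c \<le> quarter_sum G \<theta>" and r: "r + 3 * pi / (2 * k) \<le> R"
  shows "c * emeasure lborel (ball 0 r :: 'a set) \<le> (\<integral>\<^sup>+z\<in>ball 0 R. G (k * (z \<bullet> e)) \<partial>lborel)"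
proof -
  let ?I = "\<integral>\<^sup>+z\<in>ball 0 R. G (k * (z \<bullet> e)) \<partial>lborel"
  have shift: "(\<integral>\<^sup>+z\<in>ball 0 r. G (k * (z \<bullet> e) + j * (pi / 2)) \<partial>lborel) \<le> ?I" if "j < 4" for j :: nat
  proof -
    define s where "s = j * (pi / 2) / k"
    have "j * (pi / 2) \<le> 3 * (pi / 2)"
      using that by (intro mult_right_mono) auto
    then have "s \<le> 3 * pi / (2 * k)"
      using k by (simp add: s_def field_simps)
    moreover have "s \<ge> 0"
      using k by (simp add: s_def)
    ultimately have "r \<le> R - \<bar>s\<bar>"
      using r by simp
    then have "(\<integral>\<^sup>+z\<in>ball 0 r. G (k * (z \<bullet> e) + k * s) \<partial>lborel)
        \<le> (\<integral>\<^sup>+z\<in>ball 0 (R - \<bar>s\<bar>). G (k * (z \<bullet> e) + k * s) \<partial>lborel)"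
      by (intro nn_integral_mono) (auto simp: indicator_def)
    also have "\<dots> \<le> ?I"
      by (rule nn_integral_ball_shift[OF G e])
    finally show ?thesis
      using k by (simp add: s_def)
  qed
  have "4 * (c * emeasure lborel (ball 0 r :: 'a set)) = (\<integral>\<^sup>+z\<in>ball 0 r :: 'a set. 4 * c \<partial>lborel)"
    by (subst nn_integral_cmult_indicator) (simp_all add: mult.assoc)
  also have "\<dots> \<le> (\<integral>\<^sup>+z\<in>ball 0 r. quarter_sum G (k * (z \<bullet> e)) \<partial>lborel)"
    by (intro nn_integral_mono mult_right_mono avg) auto
  also have "\<dots> = (\<Sum>j<4::nat. \<integral>\<^sup>+z\<in>ball 0 r. G (k * (z \<bullet> e) + j * (pi / 2)) \<partial>lborel)"
    unfolding quarter_sum_def sum_distrib_right by (rule nn_integral_sum) (measurable, simp_all)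
  also have "\<dots> \<le> (\<Sum>j<4::nat. ?I)"
    by (intro sum_mono shift) auto
  also have "\<dots> = 4 * ?I" by simp
  finally show ?thesis
    by (subst (asm) ennreal_mult_le_mult_iff) auto
qed

text \<open>The same translation argument with the roles of the two balls exchanged.\<close>
lemma nn_integral_ball_le_quarter_average:
  fixes e :: "'a::euclidean_space" and G :: "real \<Rightarrow> ennreal"
  assumes G [measurable]: "G \<in> borel_measurable borel" and e: "norm e = 1" and k: "k > 0"
    and avg: "\<And>\<theta>. quarter_sum G \<theta> \<le> 4 * c" and r: "r + 3 * pi / (2 * k) \<le> R"
  shows "(\<integral>\<^sup>+z\<in>ball 0 r. G (k * (z \<bullet> e)) \<partial>lborel) \<le> c * emeasure lborel (ball 0 R :: 'a set)"
proof -
  let ?I = "\<integral>\<^sup>+z\<in>ball 0 r. G (k * (z \<bullet> e)) \<partial>lborel"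
  have shift: "?I \<le> (\<integral>\<^sup>+z\<in>ball 0 R. G (k * (z \<bullet> e) + j * (pi / 2)) \<partial>lborel)" if "j < 4" for j :: nat
  proof -
    define s where "s = j * (pi / 2) / k"
    have ks: "k * s = j * (pi / 2)"
      using k by (simp add: s_def)
    have "j * (pi / 2) \<le> 3 * (pi / 2)"
      using that by (intro mult_right_mono) auto
    then have "s \<le> 3 * pi / (2 * k)"
      using k by (simp add: s_def field_simps)
    moreover have "s \<ge> 0"
      using k by (simp add: s_def)
    ultimately have "r \<le> R - \<bar>- s\<bar>"
      using r by simp
    then have "?I \<le> (\<integral>\<^sup>+z\<in>ball 0 (R - \<bar>- s\<bar>). G (k * (z \<bullet> e)) \<partial>lborel)"
      by (intro nn_integral_mono) (auto simp: indicator_def)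
    also have "\<dots> = (\<integral>\<^sup>+z\<in>ball 0 (R - \<bar>- s\<bar>). G ((k * (z \<bullet> e) + k * (- s)) + j * (pi / 2)) \<partial>lborel)"
      by (simp add: ks)
    also have "\<dots> \<le> (\<integral>\<^sup>+z\<in>ball 0 R. G (k * (z \<bullet> e) + j * (pi / 2)) \<partial>lborel)"
      by (rule nn_integral_ball_shift[where G = "\<lambda>x. G (x + j * (pi / 2))", OF _ e]) measurable
    finally show ?thesis .
  qed
  have "4 * ?I = (\<Sum>j<4::nat. ?I)" by simp
  also have "\<dots> \<le> (\<Sum>j<4::nat. \<integral>\<^sup>+z\<in>ball 0 R. G (k * (z \<bullet> e) + j * (pi / 2)) \<partial>lborel)"
    by (intro sum_mono shift) auto
  also have "\<dots> = (\<integral>\<^sup>+z\<in>ball 0 R. quarter_sum G (k * (z \<bullet> e)) \<partial>lborel)"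
    unfolding quarter_sum_def sum_distrib_right by (rule nn_integral_sum[symmetric]) (measurable, simp_all)
  also have "\<dots> \<le> (\<integral>\<^sup>+z\<in>ball 0 R :: 'a set. 4 * c \<partial>lborel)"
    by (intro nn_integral_mono mult_right_mono avg) auto
  also have "\<dots> = 4 * (c * emeasure lborel (ball 0 R :: 'a set))"
    by (subst nn_integral_cmult_indicator) (simp_all add: mult.assoc)
  finally show ?thesis
    by (subst (asm) ennreal_mult_le_mult_iff) auto
qed

section \<open>From the comparison principle to averages\<close>

definition comparison_principle :: "'n::finite itself \<Rightarrow> nat \<Rightarrow> real \<Rightarrow> bool" where
  "comparison_principle _ m \<alpha> \<longleftrightarrow>
    (\<forall>(\<Omega> :: (complex^'n) set) u v.
       open \<Omega> \<longrightarrow> connected \<Omega> \<longrightarrow> \<Omega> \<noteq> {} \<longrightarrow> bounded \<Omega> \<longrightarrow>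
       m_psh m \<Omega> u \<longrightarrow> continuous_on (closure \<Omega>) u \<longrightarrow>
       m_psh m \<Omega> v \<longrightarrow> continuous_on (closure \<Omega>) v \<longrightarrow>
       (\<forall>z\<in>frontier \<Omega>. u z \<ge> v z) \<longrightarrow>
       (\<integral>\<^sup>+z\<in>{z\<in>\<Omega>. u z < v z}. ennreal (MA_op m v z powr \<alpha>) \<partial>lborel)
         \<le> (\<integral>\<^sup>+z\<in>{z\<in>\<Omega>. u z < v z}. ennreal (MA_op m u z powr \<alpha>) \<partial>lborel))"
definition MA_power :: "nat \<Rightarrow> real \<Rightarrow> ('n::finite \<Rightarrow> real) \<Rightarrow> real" where
  "MA_power m \<alpha> d = subset_sum_prod m d powr \<alpha>"

lemma subset_sum_prod_pos:
  fixes d :: "'n::finite \<Rightarrow> real"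
  assumes "1 \<le> m" "\<And>i. d i > 0"
  shows "subset_sum_prod m d > 0"
  unfolding subset_sum_prod_def
proof (intro prod_pos ballI sum_pos assms)
  fix J :: "'n set" assume "J \<in> {J. card J = m}"
  then show "J \<noteq> {}" using assms(1) by auto
qed auto

lemma continuous_on_subset_sum_prod:
  assumes "\<And>i. continuous_on S (\<lambda>t. d t i)"
  shows "continuous_on S (\<lambda>t. subset_sum_prod m (d t))"
  unfolding subset_sum_prod_def by (intro continuous_intros assms)

lemma rippled_quadratic_diff:
  fixes a :: "'n::finite \<Rightarrow> real"
  shows "rippled_quadratic a 0 l \<epsilon> k z - rippled_quadratic (\<lambda>i. a i + \<tau>) (- \<tau>) l \<epsilon>' k z
    = \<tau> * (1 - (norm z)\<^sup>2) + (\<epsilon> - \<epsilon>') * cos (k * Re (z $ l))"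
proof -
  have "(norm z)\<^sup>2 = (\<Sum>i\<in>UNIV. (cmod (z $ i))\<^sup>2)"
    by (simp only: power2_norm_eq_inner inner_vec_def)
  then show ?thesis
    by (simp add: rippled_quadratic_def algebra_simps sum.distrib sum_distrib_left)
qed

text \<open>The comparison principle on \<open>ball 0 2\<close> is applied to

    \<open>v = \<Sum> a\<^sub>i |z\<^sub>i|\<^sup>2 + (4 \<delta> / k\<^sup>2) cos (k Re z\<^sub>l)\<close>,
    \<open>u = \<Sum> (a\<^sub>i + \<tau>) |z\<^sub>i|\<^sup>2 - \<tau> - (4 \<delta>' / k\<^sup>2) cos (k Re z\<^sub>l)\<close>.

  The difference \<open>v - u\<close> is \<open>\<tau> (1 - |z|\<^sup>2)\<close> up to an error of order \<open>1/k\<^sup>2\<close>, so for large \<open>k\<close>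
  the set \<open>u < v\<close> is almost the unit ball, whereas the oscillation of the Hessians does not decay.
  Hence the integrals of the two densities are governed by their averages over the phase, and the
  comparison principle turns into the inequality between these averages. The parameter \<open>\<tau>\<close> only
  separates the two functions and is sent to \<open>0\<close> later; having a ripple in either function allows
  the principle to be used against convexity as well as against concavity.\<close>
lemma comparison_of_quarter_averages:
  fixes a :: "'n::finite \<Rightarrow> real" and l :: 'n and m :: nat and \<alpha> \<delta> \<delta>' \<tau> c C :: real
  defines "F \<equiv> MA_power m \<alpha>"
  assumes cmp: "comparison_principle TYPE('n) m \<alpha>"
    and m: "m \<le> CARD('n)"
    and a: "\<And>i. a i > 0" and \<tau>: "\<tau> > 0"
    and \<delta>: "\<bar>\<delta>\<bar> \<le> a l" and \<delta>': "\<bar>\<delta>'\<bar> \<le> a l + \<tau>"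
    and c: "\<And>\<theta>. 4 * c \<le> quarter_sum (\<lambda>x. F (a(l := a l - \<delta> * cos x))) \<theta>"
    and C: "\<And>\<theta>. quarter_sum (\<lambda>x. F ((\<lambda>i. a i + \<tau>)(l := a l + \<tau> + \<delta>' * cos x))) \<theta> \<le> 4 * C"
    and "c \<ge> 0" "C \<ge> 0"
  shows "c \<le> C"
proof -
  define G where "G = (\<lambda>x. F (a(l := a l - \<delta> * cos x)))"
  define G' where "G' = (\<lambda>x. F ((\<lambda>i. a i + \<tau>)(l := a l + \<tau> + \<delta>' * cos x)))"
  define N where "N = DIM(complex^'n)"
  have meas: "(\<lambda>x. ennreal (F (b(l := p + q * cos x)))) \<in> borel_measurable borel" for b p q
  proof -
    have "continuous_on UNIV (\<lambda>x. (b(l := p + q * cos x)) i)" for i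
      by (cases "i = l") (auto intro!: continuous_intros)
    then have "(\<lambda>x. subset_sum_prod m (b(l := p + q * cos x))) \<in> borel_measurable borel"
      by (intro borel_measurable_continuous_onI continuous_on_subset_sum_prod)
    then show ?thesis unfolding F_def MA_power_def by measurable
  qed
  have measG [measurable]: "(\<lambda>x. ennreal (G x)) \<in> borel_measurable borel"
    using meas[of a "a l" "- \<delta>"] by (simp add: G_def)
  have measG' [measurable]: "(\<lambda>x. ennreal (G' x)) \<in> borel_measurable borel"
    using meas[of "\<lambda>i. a i + \<tau>" "a l + \<tau>" "\<delta>'"] by (simp add: G'_def)
  have quarter_ennreal: "quarter_sum (\<lambda>x. ennreal (H x)) \<theta> = ennreal (quarter_sum H \<theta>)"
    if "\<And>x. H x \<ge> 0" for H \<theta>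
    using that by (simp add: quarter_sum_def sum_ennreal)
  have G0: "G x \<ge> 0" "G' x \<ge> 0" for x
    by (simp_all add: G_def G'_def F_def MA_power_def)
  have mult4: "4 * ennreal x = ennreal (4 * x)" if "x \<ge> 0" for x
    using that by (simp add: ennreal_mult)
  have avgG: "4 * ennreal c \<le> quarter_sum (\<lambda>x. ennreal (G x)) \<theta>" for \<theta>
    using c[of \<theta>, folded G_def] \<open>c \<ge> 0\<close>
    by (simp only: quarter_ennreal[of G, OF G0(1)] mult4 ennreal_leI)
  have avgG': "quarter_sum (\<lambda>x. ennreal (G' x)) \<theta> \<le> 4 * ennreal C" for \<theta>
    using C[of \<theta>, folded G'_def] \<open>C \<ge> 0\<close>
    by (simp only: quarter_ennreal[of G', OF G0(2)] mult4 ennreal_leI)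

  \<comment> \<open>The set \<open>u < v\<close> lies between the balls of radii \<open>1 - s\<close> and \<open>1 + s\<close>; the averaging costs
    another \<open>s\<close> on either side.\<close>
  have approx: "c * (1 - 2 * s) ^ N \<le> C * (1 + 2 * s) ^ N" if s: "0 < s" "s < 1/2" for s
  proof -
    \<comment> \<open>Each summand secures one bound: \<open>k \<le> k\<^sup>2\<close>, a ripple below \<open>\<tau> s\<close>, and translations
      of at most three quarters of a period below \<open>s\<close>.\<close>
    define k where "k = 1 + 4 * (\<bar>\<delta>\<bar> + \<bar>\<delta>'\<bar>) / (\<tau> * s) + 3 * pi / (2 * s)"
    have k1: "k \<ge> 1"
      using s \<tau> by (simp add: k_def)
    have "3 * pi / (2 * s) \<le> k"
      using s \<tau> by (simp add: k_def)
    then have k2: "3 * pi / (2 * k) \<le> s"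
      using s k1 by (simp add: field_simps)
    have "4 * (\<bar>\<delta>\<bar> + \<bar>\<delta>'\<bar>) / (\<tau> * s) \<le> k"
      using s \<tau> by (simp add: k_def)
    also have "k \<le> k\<^sup>2"
      using k1 by (simp add: power2_eq_square)
    finally have k3: "4 * (\<bar>\<delta>\<bar> + \<bar>\<delta>'\<bar>) / k\<^sup>2 \<le> \<tau> * s"
      using s \<tau> k1 by (simp add: field_simps)
    define v where "v = rippled_quadratic a 0 l (4 * \<delta> / k\<^sup>2) k"
    define u where "u = rippled_quadratic (\<lambda>i. a i + \<tau>) (- \<tau>) l (- (4 * \<delta>' / k\<^sup>2)) k"
    have cancel: "4 * b / k\<^sup>2 * k\<^sup>2 / 4 = b" "- (4 * b / k\<^sup>2) * k\<^sup>2 / 4 = - b" for b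
      using k1 by simp_all
    have Hv: "complex_hessian v z = (\<chi> p q. if p = q then complex_of_real
        ((a(l := a l - \<delta> * cos (k * Re (z $ l)))) p) else 0)" for z
      by (simp only: v_def complex_hessian_rippled_quadratic cancel)
    have Hu: "complex_hessian u z = (\<chi> p q. if p = q then complex_of_real
        (((\<lambda>i. a i + \<tau>)(l := a l + \<tau> + \<delta>' * cos (k * Re (z $ l)))) p) else 0)" for z
      unfolding u_def complex_hessian_rippled_quadratic cancel
      by (simp only: mult_minus_left diff_minus_eq_add)
    have cos_bound: "\<bar>b * cos x\<bar> \<le> \<bar>b\<bar>" for b x :: real
      by (simp add: abs_mult mult_left_le)
    have pshv: "m_psh m \<Omega> v" for \<Omega>
    proof (rule m_psh_diagonalI[OF _ m Hv])
      show "C2_on \<Omega> v" unfolding v_def by (rule C2_on_rippled_quadratic)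
      show "0 \<le> (a(l := a l - \<delta> * cos (k * Re (z $ l)))) p" for z p
        using a[of p] cos_bound[of \<delta> "k * Re (z $ l)"] \<delta> by auto
    qed
    have pshu: "m_psh m \<Omega> u" for \<Omega>
    proof (rule m_psh_diagonalI[OF _ m Hu])
      show "C2_on \<Omega> u" unfolding u_def by (rule C2_on_rippled_quadratic)
      show "0 \<le> ((\<lambda>i. a i + \<tau>)(l := a l + \<tau> + \<delta>' * cos (k * Re (z $ l)))) p" for z p
        using a[of p] \<tau> cos_bound[of \<delta>' "k * Re (z $ l)"] \<delta>' by auto
    qed
    define w where "w z = (4 * \<delta> / k\<^sup>2 + 4 * \<delta>' / k\<^sup>2) * cos (k * Re (z $ l))" for z :: "complex^'n"
    have diff: "v z - u z = \<tau> * (1 - (norm z)\<^sup>2) + w z" for z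
      by (simp add: v_def u_def w_def rippled_quadratic_diff)
    have w: "\<bar>w z\<bar> \<le> \<tau> * s" for z
    proof -
      have "\<bar>w z\<bar> \<le> \<bar>4 * \<delta> / k\<^sup>2 + 4 * \<delta>' / k\<^sup>2\<bar>"
        unfolding w_def by (rule cos_bound)
      also have "\<dots> \<le> \<bar>4 * \<delta> / k\<^sup>2\<bar> + \<bar>4 * \<delta>' / k\<^sup>2\<bar>"
        by (rule abs_triangle_ineq)
      also have "\<dots> = 4 * (\<bar>\<delta>\<bar> + \<bar>\<delta>'\<bar>) / k\<^sup>2"
        by (simp add: abs_mult distrib_left add_divide_distrib)
      finally show ?thesis using k3 by simp
    qed
    define S where "S = {z \<in> ball 0 2. u z < v z}"
    have inner: "ball 0 (1 - s) \<subseteq> S"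
    proof
      fix z :: "complex^'n" assume "z \<in> ball 0 (1 - s)"
      then have nz: "norm z < 1 - s" by simp
      have "(norm z)\<^sup>2 < (1 - s)\<^sup>2"
        using nz by (intro power_strict_mono) auto
      also have "\<dots> \<le> 1 - s"
        using s by (simp add: power2_eq_square mult_left_le)
      finally have "\<tau> * s < \<tau> * (1 - (norm z)\<^sup>2)"
        using \<tau> by simp
      then show "z \<in> S"
        using diff[of z] w[of z] nz s by (auto simp: S_def)
    qed
    have outer: "S \<subseteq> ball 0 (1 + s)"
    proof
      fix z assume "z \<in> S"
      then have "\<tau> * ((norm z)\<^sup>2 - 1) < \<tau> * s"
        using diff[of z] w[of z] by (auto simp: S_def algebra_simps)
      then have "(norm z)\<^sup>2 < 1 + s"
        using \<tau> by simp
      also have "\<dots> \<le> (1 + s)\<^sup>2"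
        using s by (simp add: power2_eq_square algebra_simps)
      finally show "z \<in> ball 0 (1 + s)"
        using s by (simp add: power_less_imp_less_base)
    qed
    have bdry: "\<forall>z\<in>frontier (ball 0 2). u z \<ge> v z"
    proof
      fix z :: "complex^'n" assume "z \<in> frontier (ball 0 2)"
      then have "norm z = 2" by simp
      moreover have "\<tau> * s \<le> \<tau> * 3"
        using \<tau> s by (intro mult_left_mono) auto
      ultimately show "u z \<ge> v z"
        using diff[of z] w[of z] by simp
    qed
    define e :: "complex^'n" where "e = axis l 1"
    have axis: "z \<bullet> e = Re (z $ l)" for z :: "complex^'n"
      by (simp add: e_def inner_axis)
    have MAv: "MA_op m v z = subset_sum_prod m (a(l := a l - \<delta> * cos (k * Re (z $ l))))" for z
      by (rule MA_op_diagonal) (rule Hv)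
    have MAu: "MA_op m u z = subset_sum_prod m ((\<lambda>i. a i + \<tau>)(l := a l + \<tau> + \<delta>' * cos (k * Re (z $ l))))" for z
      by (rule MA_op_diagonal) (rule Hu)
    have "(\<integral>\<^sup>+z\<in>S. ennreal (MA_op m v z powr \<alpha>) \<partial>lborel) \<le> (\<integral>\<^sup>+z\<in>S. ennreal (MA_op m u z powr \<alpha>) \<partial>lborel)"
      unfolding S_def
    proof (rule cmp[unfolded comparison_principle_def, rule_format])
      show "continuous_on (closure (ball 0 2)) u" "continuous_on (closure (ball 0 2)) v"
        unfolding u_def v_def by (rule continuous_on_rippled_quadratic)+
      show "\<And>z. z \<in> frontier (ball 0 2) \<Longrightarrow> v z \<le> u z"
        using bdry by blast
    qed (auto intro: pshu pshv)
    also have "(\<lambda>z. MA_op m v z powr \<alpha>) = (\<lambda>z. G (k * (z \<bullet> e)))"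
      by (rule ext) (simp only: MAv G_def F_def MA_power_def axis)
    also have "(\<lambda>z. MA_op m u z powr \<alpha>) = (\<lambda>z. G' (k * (z \<bullet> e)))"
      by (rule ext) (simp only: MAu G'_def F_def MA_power_def axis)
    finally have SS: "(\<integral>\<^sup>+z\<in>S. ennreal (G (k * (z \<bullet> e))) \<partial>lborel)
        \<le> (\<integral>\<^sup>+z\<in>S. ennreal (G' (k * (z \<bullet> e))) \<partial>lborel)" .
    have norm_e: "norm e = 1"
      by (simp add: e_def norm_eq_1 inner_axis_axis)
    have kpos: "k > 0" using k1 by simp
    have "ennreal c * emeasure lborel (ball 0 (1 - 2 * s) :: (complex^'n) set)
        \<le> (\<integral>\<^sup>+z\<in>ball 0 (1 - s). ennreal (G (k * (z \<bullet> e))) \<partial>lborel)"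
      using k2 by (intro nn_integral_ball_ge_quarter_average[where G = "\<lambda>x. ennreal (G x)", OF measG norm_e kpos avgG]) simp
    also have "\<dots> \<le> (\<integral>\<^sup>+z\<in>S. ennreal (G (k * (z \<bullet> e))) \<partial>lborel)"
      using inner by (intro nn_integral_mono) (auto simp: indicator_def)
    also note SS
    also have "(\<integral>\<^sup>+z\<in>S. ennreal (G' (k * (z \<bullet> e))) \<partial>lborel)
        \<le> (\<integral>\<^sup>+z\<in>ball 0 (1 + s). ennreal (G' (k * (z \<bullet> e))) \<partial>lborel)"
      using outer by (intro nn_integral_mono) (auto simp: indicator_def)
    also have "\<dots> \<le> ennreal C * emeasure lborel (ball 0 (1 + 2 * s) :: (complex^'n) set)"
      using k2 by (intro nn_integral_ball_le_quarter_average[where G = "\<lambda>x. ennreal (G' x)", OF measG' norm_e kpos avgG']) simp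
    finally have "ennreal (c * (unit_ball_vol N * (1 - 2 * s) ^ N))
        \<le> ennreal (C * (unit_ball_vol N * (1 + 2 * s) ^ N))"
      using s \<open>c \<ge> 0\<close> \<open>C \<ge> 0\<close> by (simp add: emeasure_ball N_def ennreal_mult)
    then have "unit_ball_vol N * (c * (1 - 2 * s) ^ N) \<le> unit_ball_vol N * (C * (1 + 2 * s) ^ N)"
      using s \<open>C \<ge> 0\<close> by (subst (asm) ennreal_le_iff) (auto simp: mult_ac)
    then show ?thesis
      by (simp add: unit_ball_vol_pos)
  qed
  have lim: "((\<lambda>s. c * (1 - 2 * s) ^ N) \<longlongrightarrow> c * (1 - 2 * 0) ^ N) (at_right 0)"
    by (intro tendsto_intros)
  have lim': "((\<lambda>s. C * (1 + 2 * s) ^ N) \<longlongrightarrow> C * (1 + 2 * 0) ^ N) (at_right 0)"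
    by (intro tendsto_intros)
  have "eventually (\<lambda>s::real. 0 < s \<and> s < 1/2) (at_right 0)"
    by (intro eventually_at_rightI[of 0 "1/2"]) auto
  then have "eventually (\<lambda>s. c * (1 - 2 * s) ^ N \<le> C * (1 + 2 * s) ^ N) (at_right 0)"
    by eventually_elim (auto intro: approx)
  then show ?thesis
    using tendsto_le[OF _ lim' lim] by simp
qed

section \<open>Affinity in each eigenvalue\<close>
lemma quarter_sum_cos:
  fixes f :: "real \<Rightarrow> 'b::comm_monoid_add"
  shows "quarter_sum (\<lambda>x. f (cos x)) \<theta> = (f (cos \<theta>) + f (- cos \<theta>)) + (f (sin \<theta>) + f (- sin \<theta>))"
proof -
  have three: "3 * (pi / 2) = pi + pi / 2" by simp
  have three_quarters: "cos (3 * (pi / 2)) = 0" "sin (3 * (pi / 2)) = - 1"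
    unfolding three by (simp_all only: cos_add sin_add) simp_all
  have "cos (\<theta> + pi / 2) = - sin \<theta>" "cos (\<theta> + 3 * (pi / 2)) = sin \<theta>"
    by (simp_all only: cos_add three_quarters) simp_all
  then show ?thesis
    by (simp add: quarter_sum_def eval_nat_numeral add_ac)
qed

lemma tendsto_MA_power:
  fixes a :: "'n::finite \<Rightarrow> real"
  assumes "1 \<le> m" "\<And>i. a i > 0" "\<And>i. ((\<lambda>t. d t i) \<longlongrightarrow> a i) X"
  shows "((\<lambda>t. MA_power m \<alpha> (d t)) \<longlongrightarrow> MA_power m \<alpha> a) X"
  unfolding MA_power_def
proof (intro tendsto_powr tendsto_const)
  show "((\<lambda>t. subset_sum_prod m (d t)) \<longlongrightarrow> subset_sum_prod m a) X"
    unfolding subset_sum_prod_def by (intro tendsto_intros assms)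
  show "subset_sum_prod m a \<noteq> 0"
    using subset_sum_prod_pos[of m a] assms by simp
qed

text \<open>A ripple in \<open>v\<close> alone would raise the average density of \<open>v\<close> strictly above its value at
  \<open>a\<close>, whereas the density of the unrippled \<open>u\<close> tends to that value as \<open>\<tau>\<close> tends to \<open>0\<close>.\<close>
lemma no_strict_midpoint_convexity:
  fixes a :: "'n::finite \<Rightarrow> real" and l :: 'n and m :: nat and \<alpha> r c :: real
  defines "F \<equiv> MA_power m \<alpha>"
  assumes cmp: "comparison_principle TYPE('n) m \<alpha>"
    and m: "1 \<le> m" "m \<le> CARD('n)"
    and a: "\<And>i. a i > 0" and r: "r > 0" and c: "c > 0"
    and convex: "\<And>t. \<bar>t\<bar> \<le> r \<Longrightarrow> F (a(l := a l + t)) + F (a(l := a l - t)) \<ge> 2 * F a + c * t\<^sup>2"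
  shows False
proof -
  define \<delta> where "\<delta> = min r (a l)"
  have \<delta>: "\<delta> > 0" "\<delta> \<le> r" "\<delta> \<le> a l"
    using r a[of l] by (auto simp: \<delta>_def)
  have small: "\<bar>\<delta> * x\<bar> \<le> r" if "\<bar>x\<bar> \<le> 1" for x
    using that \<delta> mult_mono[of "\<bar>\<delta>\<bar>" r "\<bar>x\<bar>" 1] by (simp add: abs_mult)
  have avg: "4 * (F a + c * \<delta>\<^sup>2 / 4) \<le> quarter_sum (\<lambda>x. F (a(l := a l - \<delta> * cos x))) \<theta>" for \<theta>
  proof -
    have "F a + F a + c * (\<delta> * x)\<^sup>2 \<le> F (a(l := a l - \<delta> * x)) + F (a(l := a l - \<delta> * - x))"
      if "\<bar>x\<bar> \<le> 1" for x
      using convex[OF small[OF that]] by simp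
    from this[of "cos \<theta>"] this[of "sin \<theta>"]
    have "4 * F a + (c * (\<delta> * cos \<theta>)\<^sup>2 + c * (\<delta> * sin \<theta>)\<^sup>2)
        \<le> quarter_sum (\<lambda>x. F (a(l := a l - \<delta> * cos x))) \<theta>"
      by (simp add: quarter_sum_cos[of "\<lambda>x. F (a(l := a l - \<delta> * x))"])
    moreover have "c * (\<delta> * cos \<theta>)\<^sup>2 + c * (\<delta> * sin \<theta>)\<^sup>2 = c * \<delta>\<^sup>2 * ((cos \<theta>)\<^sup>2 + (sin \<theta>)\<^sup>2)"
      by (simp only: power_mult_distrib distrib_left mult.assoc)
    ultimately show ?thesis by simp
  qed
  have "F a + c * \<delta>\<^sup>2 / 4 \<le> F (\<lambda>i. a i + \<tau>)" if "\<tau> > 0" for \<tau>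
  proof (rule comparison_of_quarter_averages[where a = a and l = l and \<delta> = \<delta> and \<delta>' = 0,
        OF cmp m(2) a that, folded F_def])
    show "quarter_sum (\<lambda>x. F ((\<lambda>i. a i + \<tau>)(l := a l + \<tau> + 0 * cos x))) \<theta> \<le> 4 * F (\<lambda>i. a i + \<tau>)" for \<theta>
      by (simp add: quarter_sum_def fun_upd_idem)
  qed (use avg \<delta> c a[of l] that in \<open>auto simp: F_def MA_power_def\<close>)
  then have "eventually (\<lambda>\<tau>. F a + c * \<delta>\<^sup>2 / 4 \<le> F (\<lambda>i. a i + \<tau>)) (at_right 0)"
    by (intro eventually_at_rightI[of 0 1]) auto
  moreover have "((\<lambda>\<tau>. F (\<lambda>i. a i + \<tau>)) \<longlongrightarrow> F a) (at_right 0)"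
    unfolding F_def by (intro tendsto_MA_power m a) (auto intro!: tendsto_eq_intros)
  ultimately have "F a + c * \<delta>\<^sup>2 / 4 \<le> F a"
    by (intro tendsto_lowerbound) auto
  then show False
    using c \<delta> by (simp add: mult_le_0_iff)
qed

text \<open>Here the ripple sits in \<open>u\<close> and lowers its average density. The fixed point \<open>a\<close> is now the
  Hessian of \<open>u\<close> without ripple, and \<open>v\<close> approaches it from below as \<open>a - \<tau>\<close>, so that the ripple
  is centred at \<open>a\<close> for every \<open>\<tau>\<close>.\<close>
lemma no_strict_midpoint_concavity:
  fixes a :: "'n::finite \<Rightarrow> real" and l :: 'n and m :: nat and \<alpha> r c :: real
  defines "F \<equiv> MA_power m \<alpha>"
  assumes cmp: "comparison_principle TYPE('n) m \<alpha>"
    and m: "1 \<le> m" "m \<le> CARD('n)"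
    and a: "\<And>i. a i > 0" and r: "r > 0" and c: "c > 0"
    and concave: "\<And>t. \<bar>t\<bar> \<le> r \<Longrightarrow> F (a(l := a l + t)) + F (a(l := a l - t)) \<le> 2 * F a - c * t\<^sup>2"
  shows False
proof -
  define \<delta> where "\<delta> = min r (a l)"
  have \<delta>: "\<delta> > 0" "\<delta> \<le> r" "\<delta> \<le> a l"
    using r a[of l] by (auto simp: \<delta>_def)
  have small: "\<bar>\<delta> * x\<bar> \<le> r" if "\<bar>x\<bar> \<le> 1" for x
    using that \<delta> mult_mono[of "\<bar>\<delta>\<bar>" r "\<bar>x\<bar>" 1] by (simp add: abs_mult)
  have F0: "F d \<ge> 0" for d
    by (simp add: F_def MA_power_def)
  have avg: "quarter_sum (\<lambda>x. F (a(l := a l + \<delta> * cos x))) \<theta> \<le> 4 * (F a - c * \<delta>\<^sup>2 / 4)" for \<theta>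
  proof -
    have "F (a(l := a l + \<delta> * x)) + F (a(l := a l + \<delta> * - x)) \<le> F a + F a - c * (\<delta> * x)\<^sup>2"
      if "\<bar>x\<bar> \<le> 1" for x
      using concave[OF small[OF that]] by simp
    from this[of "cos \<theta>"] this[of "sin \<theta>"]
    have "quarter_sum (\<lambda>x. F (a(l := a l + \<delta> * cos x))) \<theta>
        \<le> 4 * F a - (c * (\<delta> * cos \<theta>)\<^sup>2 + c * (\<delta> * sin \<theta>)\<^sup>2)"
      by (simp add: quarter_sum_cos[of "\<lambda>x. F (a(l := a l + \<delta> * x))"])
    moreover have "c * (\<delta> * cos \<theta>)\<^sup>2 + c * (\<delta> * sin \<theta>)\<^sup>2 = c * \<delta>\<^sup>2 * ((cos \<theta>)\<^sup>2 + (sin \<theta>)\<^sup>2)"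
      by (simp only: power_mult_distrib distrib_left mult.assoc)
    ultimately show ?thesis by simp
  qed
  have "0 \<le> quarter_sum (\<lambda>x. F (a(l := a l + \<delta> * cos x))) 0"
    unfolding quarter_sum_def by (intro sum_nonneg F0)
  then have C0: "0 \<le> F a - c * \<delta>\<^sup>2 / 4"
    using avg[of 0] by simp
  have le: "F (\<lambda>i. a i - \<tau>) \<le> F a - c * \<delta>\<^sup>2 / 4" if \<tau>: "\<tau> > 0" "\<And>i. \<tau> < a i" for \<tau>
  proof (rule comparison_of_quarter_averages[where a = "\<lambda>i. a i - \<tau>" and l = l and \<tau> = \<tau>
        and \<delta> = 0 and \<delta>' = \<delta>, OF cmp m(2) _ \<tau>(1), folded F_def])
    show "4 * F (\<lambda>i. a i - \<tau>) \<le> quarter_sum (\<lambda>x. F ((\<lambda>i. a i - \<tau>)(l := a l - \<tau> - 0 * cos x))) \<theta>" for \<theta>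
      by (simp add: quarter_sum_def fun_upd_idem)
  qed (use avg \<delta> C0 F0 \<tau> less_imp_le[OF \<tau>(2)] in auto)
  define b where "b = Min (range a)"
  have b: "b > 0" "b \<le> a i" for i
    using a by (auto simp: b_def)
  have "eventually (\<lambda>\<tau>. F (\<lambda>i. a i - \<tau>) \<le> F a - c * \<delta>\<^sup>2 / 4) (at_right 0)"
    using b by (intro eventually_at_rightI[of 0 b] le) (auto intro: less_le_trans)
  moreover have "((\<lambda>\<tau>. F (\<lambda>i. a i - \<tau>)) \<longlongrightarrow> F a) (at_right 0)"
    unfolding F_def by (intro tendsto_MA_power m a) (auto intro!: tendsto_eq_intros)
  ultimately have "F a \<le> F a - c * \<delta>\<^sup>2 / 4"
    by (intro tendsto_upperbound) auto
  then show False
    using c \<delta> by (simp add: mult_le_0_iff)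
qed

text \<open>Near \<open>x\<close> the second derivative exceeds a constant \<open>c > 0\<close>, so subtracting \<open>c t\<^sup>2 / 2\<close> leaves
  a convex function.\<close>
lemma midpoint_gap_of_positive_second_derivative:
  fixes f :: "real \<Rightarrow> real"
  assumes x: "x > 0"
    and f: "\<And>t. t > 0 \<Longrightarrow> (f has_real_derivative f' t) (at t)"
    and f': "\<And>t. t > 0 \<Longrightarrow> (f' has_real_derivative f'' t) (at t)"
    and cont: "continuous (at x) f''" and pos: "f'' x > 0"
  obtains r c where "r > 0" "c > 0" "\<And>t. \<bar>t\<bar> \<le> r \<Longrightarrow> f (x + t) + f (x - t) \<ge> 2 * f x + c * t\<^sup>2"
proof -
  define c where "c = f'' x / 2"
  have c: "c > 0" "c < f'' x"
    using pos by (simp_all add: c_def)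
  have "eventually (\<lambda>t. f'' t > c) (at x)"
    using order_tendstoD(1)[OF cont[unfolded continuous_at]] c by blast
  then obtain d where d: "d > 0" "\<And>t. t \<noteq> x \<Longrightarrow> dist t x < d \<Longrightarrow> f'' t > c"
    unfolding eventually_at by auto
  define r where "r = min d x / 2"
  have r: "r > 0" "r < d" "r < x"
    using d x by (auto simp: r_def)
  have ge: "f'' t \<ge> c" if "t \<in> {x - r..x + r}" for t
  proof (cases "t = x")
    case False
    have "\<bar>t - x\<bar> \<le> r" using that by (auto simp: abs_le_iff)
    then show ?thesis
      using d(2)[OF False] r by (simp add: dist_real_def)
  qed (use c in simp)
  have conv: "convex_on {x - r..x + r} (\<lambda>t. f t - c / 2 * t\<^sup>2)"
  proof (rule f''_ge0_imp_convex)
    fix t assume t: "t \<in> {x - r..x + r}"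
    then have "t > 0" using r by auto
    show "((\<lambda>t. f t - c / 2 * t\<^sup>2) has_real_derivative f' t - c * t) (at t)"
      by (auto intro!: derivative_eq_intros f[OF \<open>t > 0\<close>])
    show "((\<lambda>t. f' t - c * t) has_real_derivative f'' t - c) (at t)"
      by (auto intro!: derivative_eq_intros f'[OF \<open>t > 0\<close>])
    show "0 \<le> f'' t - c" using ge[OF t] by simp
  qed simp
  have "f (x + t) + f (x - t) \<ge> 2 * f x + c * t\<^sup>2" if "\<bar>t\<bar> \<le> r" for t
  proof -
    have "f ((1 - 1/2) *\<^sub>R (x + t) + (1/2) *\<^sub>R (x - t)) - c / 2 * ((1 - 1/2) *\<^sub>R (x + t) + (1/2) *\<^sub>R (x - t))\<^sup>2
      \<le> (1 - 1/2) * (f (x + t) - c / 2 * (x + t)\<^sup>2) + 1/2 * (f (x - t) - c / 2 * (x - t)\<^sup>2)"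
      using that by (intro convex_onD[OF conv]) auto
    moreover have "(1 - 1/2) *\<^sub>R (x + t) + (1/2) *\<^sub>R (x - t) = x"
      by (simp add: field_simps)
    ultimately show ?thesis
      by (simp add: power2_eq_square field_simps)
  qed
  then show ?thesis
    using that r(1) c(1) by blast
qed

text \<open>Logarithmic differentiation: \<open>\<alpha> A\<close> is the derivative of \<open>ln f\<close>, and \<open>A' = - B\<close>.\<close>
lemma second_derivative_powr_prod_affine:
  fixes p e :: "'i \<Rightarrow> real" and \<alpha> t :: real
  assumes "finite I" and pos: "\<And>i t. i \<in> I \<Longrightarrow> t > 0 \<Longrightarrow> p i + e i * t > 0"
  defines "f \<equiv> \<lambda>t. (\<Prod>i\<in>I. p i + e i * t) powr \<alpha>"
    and "A \<equiv> \<lambda>t. \<Sum>i\<in>I. e i / (p i + e i * t)"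
    and "B \<equiv> \<lambda>t. \<Sum>i\<in>I. (e i / (p i + e i * t))\<^sup>2"
  shows "t > 0 \<Longrightarrow> (f has_real_derivative \<alpha> * A t * f t) (at t)"
    and "t > 0 \<Longrightarrow>
      ((\<lambda>t. \<alpha> * A t * f t) has_real_derivative \<alpha> * (\<alpha> * (A t)\<^sup>2 - B t) * f t) (at t)"
    and "t > 0 \<Longrightarrow> continuous (at t) (\<lambda>t. \<alpha> * (\<alpha> * (A t)\<^sup>2 - B t) * f t)"
proof -
  have f: "(f has_real_derivative \<alpha> * A t * f t) (at t)" if t: "t > 0" for t
  proof -
    let ?E = "\<lambda>t. exp (\<alpha> * (\<Sum>i\<in>I. ln (p i + e i * t)))"
    have E: "f s = ?E s" if "s > 0" for s
    proof -
      have nonzero: "p i + e i * s \<noteq> 0" if "i \<in> I" for i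
        using pos[OF that \<open>s > 0\<close>] by simp
      have "(\<Prod>i\<in>I. p i + e i * s) > 0"
        using pos that by (intro prod_pos) auto
      moreover have "ln (\<Prod>i\<in>I. p i + e i * s) = (\<Sum>i\<in>I. ln (p i + e i * s))"
        using nonzero assms(1) by (intro ln_prod) auto
      ultimately show ?thesis
        by (simp add: f_def powr_def)
    qed
    have "((\<lambda>s. \<Sum>i\<in>I. ln (p i + e i * s)) has_real_derivative A t) (at t)"
      unfolding A_def using pos[OF _ t]
      by (intro DERIV_sum) (auto intro!: derivative_eq_intros simp: divide_simps)
    then have "(?E has_real_derivative ?E t * (\<alpha> * A t)) (at t)"
      by (intro DERIV_fun_exp DERIV_cmult)
    then have deriv: "(?E has_real_derivative \<alpha> * A t * f t) (at t)"
      using E[OF t] by (simp add: mult.commute)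
    have "eventually (\<lambda>s. ?E s = f s) (nhds t)"
      using eventually_nhds_in_open[of "{0<..}" t] t by (auto elim!: eventually_mono simp: E)
    from DERIV_cong_ev[OF refl this refl] deriv show ?thesis
      by blast
  qed
  have A: "(A has_real_derivative - B t) (at t)" if t: "t > 0" for t
  proof -
    have "((\<lambda>s. e i / (p i + e i * s)) has_real_derivative - (e i / (p i + e i * t))\<^sup>2) (at t)"
      if "i \<in> I" for i
      using pos[OF that t] by (auto intro!: derivative_eq_intros simp: power2_eq_square)
    then show ?thesis
      unfolding A_def B_def sum_negf[symmetric] by (intro DERIV_sum) auto
  qed
  show "t > 0 \<Longrightarrow> (f has_real_derivative \<alpha> * A t * f t) (at t)"
    by (rule f)
  show "((\<lambda>t. \<alpha> * A t * f t) has_real_derivative \<alpha> * (\<alpha> * (A t)\<^sup>2 - B t) * f t) (at t)" if "t > 0"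
    by (auto intro!: derivative_eq_intros f[OF that] A[OF that] simp: power2_eq_square algebra_simps)
  show "continuous (at t) (\<lambda>t. \<alpha> * (\<alpha> * (A t)\<^sup>2 - B t) * f t)" if t: "t > 0"
  proof -
    have "continuous (at t) A" "continuous (at t) f"
      using A[OF t] f[OF t] DERIV_isCont by blast+
    moreover have "continuous (at t) B"
      unfolding B_def using pos[OF _ t] by (intro continuous_intros) force
    ultimately show ?thesis
      by (intro continuous_intros)
  qed
qed

text \<open>Excluding both signs of the second derivative of the density in the eigenvalue \<open>a l\<close> forces it
  to vanish at every positive diagonal matrix. After division by the density this is the stated
  identity for the reciprocals \<open>x J\<close> of the sums that contain \<open>a l\<close>; the indicator discards the
  factors that do not depend on \<open>a l\<close>.\<close>
lemma second_derivative_vanishes: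
  fixes a :: "'n::finite \<Rightarrow> real" and l :: 'n
  assumes cmp: "comparison_principle TYPE('n) m \<alpha>"
    and m: "1 \<le> m" "m \<le> CARD('n)" and \<alpha>: "\<alpha> > 0"
    and a: "\<And>i. a i > 0"
  defines "x \<equiv> \<lambda>J :: 'n set. of_bool (l \<in> J) / (\<Sum>i\<in>J. a i)"
  shows "\<alpha> * (\<Sum>J | card J = m. x J)\<^sup>2 = (\<Sum>J | card J = m. (x J)\<^sup>2)"
proof -
  let ?I = "{J :: 'n set. card J = m}"
  let ?F = "MA_power m \<alpha>"
  define p where "p J = (\<Sum>i\<in>J - {l}. a i)" for J
  define e :: "'n set \<Rightarrow> real" where "e J = of_bool (l \<in> J)" for J
  have sums: "(\<Sum>i\<in>J. (a(l := t)) i) = p J + e J * t" for J t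
  proof -
    have "(\<Sum>i\<in>J. (a(l := t)) i) = (\<Sum>i\<in>J - {l}. (a(l := t)) i) + e J * t"
      by (cases "l \<in> J") (simp_all add: e_def sum.remove add.commute)
    also have "(\<Sum>i\<in>J - {l}. (a(l := t)) i) = p J"
      unfolding p_def by (intro sum.cong) auto
    finally show ?thesis .
  qed
  have F: "?F (a(l := t)) = (\<Prod>J\<in>?I. p J + e J * t) powr \<alpha>" for t
    by (simp only: MA_power_def subset_sum_prod_def sums)
  have pos: "p J + e J * t > 0" if "J \<in> ?I" "t > 0" for J t
  proof -
    have "J \<noteq> {}" using that m by auto
    then show ?thesis
      unfolding sums[symmetric] using a that by (intro sum_pos) auto
  qed
  define f where "f = (\<lambda>t. ?F (a(l := t)))"
  define A where "A t = (\<Sum>J\<in>?I. e J / (p J + e J * t))" for t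
  define B where "B t = (\<Sum>J\<in>?I. (e J / (p J + e J * t))\<^sup>2)" for t
  define f'' where "f'' t = \<alpha> * (\<alpha> * (A t)\<^sup>2 - B t) * f t" for t
  have f: "(f has_real_derivative \<alpha> * A t * f t) (at t)"
    and f': "((\<lambda>t. \<alpha> * A t * f t) has_real_derivative f'' t) (at t)"
    and cont: "continuous (at t) f''" if "t > 0" for t
    unfolding f''_def f_def F A_def B_def
    using that by (auto intro!: second_derivative_powr_prod_affine pos)
  have fa: "f (a l) = ?F a" "f (a l) > 0"
    using subset_sum_prod_pos[of m a] m a by (simp_all add: f_def MA_power_def)
  have "\<not> f'' (a l) > 0"
  proof
    assume "f'' (a l) > 0"
    then obtain r c where "r > 0" "c > 0"
      "\<And>t. \<bar>t\<bar> \<le> r \<Longrightarrow> f (a l + t) + f (a l - t) \<ge> 2 * f (a l) + c * t\<^sup>2"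
      using midpoint_gap_of_positive_second_derivative[OF a f f' cont] a by metis
    then show False
      using no_strict_midpoint_convexity[where a = a and l = l and r = r and c = c, OF cmp m a] fa by (simp add: f_def)
  qed
  moreover have "\<not> f'' (a l) < 0"
  proof
    assume neg: "f'' (a l) < 0"
    obtain r c where rc: "r > 0" "c > 0"
      "\<And>t. \<bar>t\<bar> \<le> r \<Longrightarrow> - f (a l + t) + - f (a l - t) \<ge> 2 * - f (a l) + c * t\<^sup>2"
    proof (rule midpoint_gap_of_positive_second_derivative[of "a l" "\<lambda>t. - f t"
          "\<lambda>t. - (\<alpha> * A t * f t)" "\<lambda>t. - f'' t"])
      show "continuous (at (a l)) (\<lambda>t. - f'' t)"
        using cont[OF a] by (rule continuous_minus)
    qed (use neg a f f' in \<open>auto intro!: DERIV_minus\<close>)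
    have "f (a l + t) + f (a l - t) \<le> 2 * f (a l) - c * t\<^sup>2" if "\<bar>t\<bar> \<le> r" for t
      using rc(3)[OF that] by simp
    then show False
      using no_strict_midpoint_concavity[where a = a and l = l and r = r and c = c, OF cmp m a rc(1,2)] fa by (simp add: f_def)
  qed
  ultimately have "f'' (a l) = 0" by simp
  then have "\<alpha> * (A (a l))\<^sup>2 = B (a l)"
    using \<alpha> fa(2) by (simp add: f''_def)
  moreover have "e J / (p J + e J * a l) = x J" for J
    proof -
    have "p J + e J * a l = (\<Sum>i\<in>J. a i)"
      using sums by (metis fun_upd_triv)
    then show ?thesis by (simp only: x_def e_def)
  qed
  ultimately show ?thesis
    by (simp add: A_def B_def)
qed

section \<open>Evaluation at two diagonal matrices\<close>

text \<open>The equality case of the Cauchy-Schwarz inequality against the constant family: the variance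
  of \<open>x\<close> vanishes.\<close>
lemma constant_if_power_mean_equality:
  fixes x :: "'i \<Rightarrow> real"
  assumes I: "finite I" and eq: "(\<Sum>i\<in>I. x i)\<^sup>2 = card I * (\<Sum>i\<in>I. (x i)\<^sup>2)"
    and ij: "i \<in> I" "j \<in> I"
  shows "x i = x j"
proof -
  have K: "real (card I) > 0"
    using I ij by (auto simp: card_gt_0_iff)
  define M where "M = (\<Sum>i\<in>I. x i) / card I"
  have expand: "(x i - M)\<^sup>2 = (x i)\<^sup>2 - 2 * M * x i + M\<^sup>2" for i
    by (simp add: power2_diff)
  have "(\<Sum>i\<in>I. (x i - M)\<^sup>2) = (\<Sum>i\<in>I. (x i)\<^sup>2) - 2 * M * (\<Sum>i\<in>I. x i) + card I * M\<^sup>2"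
    by (simp add: expand sum.distrib sum_subtractf flip: sum_distrib_left)
  also have "\<dots> = 0"
    using K eq by (simp add: M_def power2_eq_square field_simps)
  finally have "\<forall>i\<in>I. (x i - M)\<^sup>2 = 0"
    using I by (subst (asm) sum_nonneg_eq_0_iff) auto
  then show ?thesis
    using ij by simp
qed

lemma card_subsets_containing_eq_1:
  fixes l :: "'n::finite"
  assumes "m = 1 \<or> m = CARD('n)"
  shows "card {J :: 'n set. card J = m \<and> l \<in> J} = 1"
proof -
  have "{J :: 'n set. card J = m \<and> l \<in> J} = {if m = 1 then {l} else UNIV}"
    using assms card_subset_eq[OF finite subset_UNIV] by (auto simp: card_1_singleton_iff)
  then show ?thesis by simp
qed

text \<open>At the identity matrix all sums equal \<open>m\<close>, and \<open>second_derivative_vanishes\<close> says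
  \<open>\<alpha> K = 1\<close>, where \<open>K\<close> is the number of \<open>m\<close>-subsets containing \<open>l\<close>. The identity then becomes
  equality in the Cauchy-Schwarz inequality at every other positive diagonal matrix, so that all
  sums over \<open>m\<close>-subsets containing \<open>l\<close> agree. Doubling one entry with index \<open>b \<noteq> l\<close> contradicts
  this as soon as some of these subsets contain \<open>b\<close> and others do not, that is for \<open>1 < m < n\<close>. In
  the remaining cases \<open>K = 1\<close>.\<close>
lemma comparison_principle_imp:
  assumes cmp: "comparison_principle TYPE('n::finite) m \<alpha>"
    and m: "1 \<le> m" "m \<le> CARD('n)" and \<alpha>: "\<alpha> > 0"
  shows "\<alpha> = 1 \<and> (m = 1 \<or> m = CARD('n))"
proof -
  obtain l :: 'n where True by blast
  define S where "S = {J :: 'n set. card J = m \<and> l \<in> J}"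
  define K where "K = real (card S)"
  have weights: "\<alpha> * (\<Sum>J\<in>S. 1 / (\<Sum>i\<in>J. a i))\<^sup>2 = (\<Sum>J\<in>S. (1 / (\<Sum>i\<in>J. a i))\<^sup>2)"
    if "\<And>i. a i > 0" for a :: "'n \<Rightarrow> real"
  proof -
    have restrict: "(\<Sum>J | card J = m. g J) = (\<Sum>J\<in>S. g J)"
      if "\<And>J. l \<notin> J \<Longrightarrow> g J = 0" for g :: "'n set \<Rightarrow> real"
      using that by (intro sum.mono_neutral_right) (auto simp: S_def)
    have "(\<Sum>J | card J = m. of_bool (l \<in> J) / (\<Sum>i\<in>J. a i)) = (\<Sum>J\<in>S. 1 / (\<Sum>i\<in>J. a i))"
      by (subst restrict) (auto simp: S_def intro!: sum.cong)
    moreover have "(\<Sum>J | card J = m. (of_bool (l \<in> J) / (\<Sum>i\<in>J. a i))\<^sup>2)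
        = (\<Sum>J\<in>S. (1 / (\<Sum>i\<in>J. a i))\<^sup>2)"
      by (subst restrict) (auto simp: S_def intro!: sum.cong)
    ultimately show ?thesis
      using second_derivative_vanishes[where a = a and l = l, OF cmp m \<alpha>] that by simp
  qed
  have "m - 1 \<le> card (UNIV - {l})"
    using m by (simp add: card_Diff_subset)
  then obtain J0 where "J0 \<subseteq> UNIV - {l}" "card J0 = m - 1"
    by (rule obtain_subset_with_card_n)
  then have "insert l J0 \<in> S"
    using m by (auto simp: S_def card_insert_if finite_subset)
  then have K: "K > 0"
    by (auto simp: K_def card_gt_0_iff)
  have "\<alpha> * (K / m)\<^sup>2 = K * (1 / m)\<^sup>2"
    using weights[of "\<lambda>_. 1"] by (simp add: S_def K_def power_divide)
  then have \<alpha>K: "\<alpha> * K = 1"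
    using K m by (simp add: power2_eq_square field_simps)
  have "m = 1 \<or> m = CARD('n)"
  proof (rule ccontr)
    assume "\<not> ?thesis"
    then have m1: "m \<ge> 2" "m < CARD('n)" using m by auto
    have "UNIV \<noteq> {l}"
    proof
      assume "UNIV = {l}"
      then have "CARD('n) = card {l}" by (rule arg_cong)
      then show False using m1 by simp
    qed
    then obtain b where b: "b \<noteq> l" by auto
    have rest: "card (UNIV - {l, b}) = CARD('n) - 2"
      using b by (simp add: card_Diff_subset)
    have "m - 2 \<le> card (UNIV - {l, b})" "m - 1 \<le> card (UNIV - {l, b})"
      using m1 unfolding rest by simp_all
    then obtain J1 J2 where J1: "J1 \<subseteq> UNIV - {l, b}" "card J1 = m - 2"
      and J2: "J2 \<subseteq> UNIV - {l, b}" "card J2 = m - 1"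
      by (meson obtain_subset_with_card_n)
    define a :: "'n \<Rightarrow> real" where "a = (\<lambda>_. 1)(b := 2)"
    have apos: "a i > 0" for i by (simp add: a_def)
    have "\<alpha> * (\<Sum>J\<in>S. 1 / (\<Sum>i\<in>J. a i))\<^sup>2 = (\<Sum>J\<in>S. (1 / (\<Sum>i\<in>J. a i))\<^sup>2)"
      by (rule weights[OF apos])
    then have "(\<Sum>J\<in>S. 1 / (\<Sum>i\<in>J. a i))\<^sup>2 = card S * (\<Sum>J\<in>S. (1 / (\<Sum>i\<in>J. a i))\<^sup>2)"
      using \<alpha>K unfolding K_def by (metis mult.assoc mult.commute mult_1)
    moreover have S1: "insert l (insert b J1) \<in> S" and S2: "insert l J2 \<in> S"
      using J1 J2 b m1 by (auto simp: S_def card_insert_if finite_subset)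
    ultimately have "1 / (\<Sum>i\<in>insert l (insert b J1). a i) = 1 / (\<Sum>i\<in>insert l J2. a i)"
      by (intro constant_if_power_mean_equality[of S]) auto
    moreover have count: "(\<Sum>i\<in>J. a i) = real (card J)" if "b \<notin> J" for J
    proof -
      have "(\<Sum>i\<in>J. a i) = (\<Sum>i\<in>J. 1)"
        using that by (intro sum.cong) (auto simp: a_def)
      then show ?thesis by simp
    qed
    moreover have "(\<Sum>i\<in>insert l (insert b J1). a i) = m + 1"
    proof -
      have "l \<notin> insert b J1" "b \<notin> J1" using J1 b by auto
      then have "(\<Sum>i\<in>insert l (insert b J1). a i) = a l + a b + real (card J1)"
        using count by simp
      then show ?thesis
        using J1 b m1 by (simp add: a_def of_nat_diff)
    qed
    moreover have "(\<Sum>i\<in>insert l J2. a i) = m"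
      using S2 J2 b by (subst count) (auto simp: S_def)
    ultimately show False
      using m by (simp add: field_simps)
  qed
  moreover from this have "K = 1"
    using card_subsets_containing_eq_1[of m l] by (simp add: K_def S_def)
  ultimately show ?thesis
    using \<alpha>K by simp
qed

theorem theorem3p1:
  fixes m :: nat and \<alpha> :: real
  assumes m: "1 \<le> m" "m \<le> CARD('n::finite)"
    and \<alpha>: "\<alpha> > 0"
    and comparison:
      "\<And>(\<Omega> :: (complex^'n) set) (u :: complex^'n \<Rightarrow> real) v.
         \<lbrakk>open \<Omega>; connected \<Omega>; \<Omega> \<noteq> {}; bounded \<Omega>;
          m_psh m \<Omega> u; continuous_on (closure \<Omega>) u;
          m_psh m \<Omega> v; continuous_on (closure \<Omega>) v;
          \<forall>z\<in>frontier \<Omega>. u z \<ge> v z\<rbrakk>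
         \<Longrightarrow> (\<integral>\<^sup>+z\<in>{z\<in>\<Omega>. u z < v z}. ennreal (MA_op m v z powr \<alpha>) \<partial>lborel)
             \<le> (\<integral>\<^sup>+z\<in>{z\<in>\<Omega>. u z < v z}. ennreal (MA_op m u z powr \<alpha>) \<partial>lborel)"
  shows "\<alpha> = 1 \<and> (m = 1 \<or> m = CARD('n))"
proof (rule comparison_principle_imp[OF _ m \<alpha>])
  show "comparison_principle TYPE('n) m \<alpha>"
    unfolding comparison_principle_def using comparison by blast
qed

end
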